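(* Let $\Gamma$ be a Neumaier graph with coherent rank at most $6$. Then the coherent closure $\mathcal W(\Gamma)$ is symmetric.
   Context: A Neumaier graph is a non-complete edge-regular graph (regular, every edge in a constant number of triangles) having a clique $C$ such that every vertex outside $C$ is adjacent to exactly $e>0$ vertices of $C$. A coherent algebra is a subalgebra of complex square matrices containing $I$ and $J$, closed under transpose, matrix product and entrywise product; it has a unique basis of $\{0,1\}$-matrices summing to $J$ (its underlying coherent configuration), and it is called symmetric if every matrix in this basis is symmetric. The coherent closure $\mathcal W(\Gamma)$ is the smallest coherent algebra containing the adjacency matrix $A(\Gamma)$; the coherent rank is its dimension. *)

theory Defs
  imports "HOL-Analysis.Analysis"
begin

text \<open>Finite simple graphs are symmetric irreflexive relations on a finite vertex type.\<close>

definition simple_graph :: "('v \<Rightarrow> 'v \<Rightarrow> bool) \<Rightarrow> bool" where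
  "simple_graph adj \<longleftrightarrow> symp adj \<and> irreflp adj"

definition complete_graph :: "('v \<Rightarrow> 'v \<Rightarrow> bool) \<Rightarrow> bool" where
  "complete_graph adj \<longleftrightarrow> (\<forall>u v. u \<noteq> v \<longrightarrow> adj u v)"

definition edge_regular :: "('v::finite \<Rightarrow> 'v \<Rightarrow> bool) \<Rightarrow> bool" where
  "edge_regular adj \<longleftrightarrow>
     (\<exists>k. \<forall>v. card {u. adj v u} = k) \<and>
     (\<exists>l. \<forall>u v. adj u v \<longrightarrow> card {w. adj u w \<and> adj v w} = l)"

definition clique :: "('v \<Rightarrow> 'v \<Rightarrow> bool) \<Rightarrow> 'v set \<Rightarrow> bool" where
  "clique adj C \<longleftrightarrow> (\<forall>u\<in>C. \<forall>v\<in>C. u \<noteq> v \<longrightarrow> adj u v)"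

definition neumaier_graph :: "('v::finite \<Rightarrow> 'v \<Rightarrow> bool) \<Rightarrow> bool" where
  "neumaier_graph adj \<longleftrightarrow>
     simple_graph adj \<and> \<not> complete_graph adj \<and> edge_regular adj \<and>
     (\<exists>C e. clique adj C \<and> e > 0 \<and> (\<forall>v. v \<notin> C \<longrightarrow> card {u \<in> C. adj v u} = e))"

definition adjacency_matrix :: "('v::finite \<Rightarrow> 'v \<Rightarrow> bool) \<Rightarrow> complex^'v^'v" where
  "adjacency_matrix adj = (\<chi> i j. if adj i j then 1 else 0)"

definition cmat_scale :: "complex \<Rightarrow> complex^'n^'n \<Rightarrow> complex^'n^'n" where
  "cmat_scale c A = (\<chi> i j. c * A $ i $ j)"

text \<open>
  The classes available on complex matrices only give their structure as a real vector space,
  so that the constants \<^const>\<open>dim\<close>, \<^const>\<open>span\<close> etc. are the real ones.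
  The interpretation below provides the complex ones under the prefix \<open>cmat\<close>.
\<close>

global_interpretation cmat: vector_space "cmat_scale :: complex \<Rightarrow> complex^'n^'n \<Rightarrow> complex^'n^'n"
  by unfold_locales (simp_all add: cmat_scale_def vec_eq_iff algebra_simps)

text \<open>
  On matrices, \<open>1\<close> is the all-ones matrix \<open>J\<close>, \<open>*\<close> is the entrywise product,
  \<open>mat 1\<close> is the identity matrix \<open>I\<close> and \<open>**\<close> is the matrix product.
\<close>

definition coherent_algebra :: "(complex^'n^'n) set \<Rightarrow> bool" where
  "coherent_algebra W \<longleftrightarrow>
     cmat.subspace W \<and> mat 1 \<in> W \<and> 1 \<in> W \<and>
     (\<forall>A\<in>W. transpose A \<in> W) \<and>
     (\<forall>A\<in>W. \<forall>B\<in>W. A ** B \<in> W) \<and>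
     (\<forall>A\<in>W. \<forall>B\<in>W. A * B \<in> W)"

definition coherent_closure :: "('v::finite \<Rightarrow> 'v \<Rightarrow> bool) \<Rightarrow> (complex^'v^'v) set" where
  "coherent_closure adj = coherent_algebra hull {adjacency_matrix adj}"

definition coherent_rank :: "('v::finite \<Rightarrow> 'v \<Rightarrow> bool) \<Rightarrow> nat" where
  "coherent_rank adj = cmat.dim (coherent_closure adj)"

definition coherent_configuration :: "(complex^'n^'n) set \<Rightarrow> (complex^'n^'n) set \<Rightarrow> bool" where
  "coherent_configuration W \<B> \<longleftrightarrow>
     cmat.independent \<B> \<and> cmat.span \<B> = W \<and>
     (\<forall>M\<in>\<B>. \<forall>i j. M $ i $ j \<in> {0, 1}) \<and> \<Sum>\<B> = 1"

text \<open>
  Every coherent algebra has exactly one basis as in \<^const>\<open>coherent_configuration\<close>, so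
  the existential quantifier below just names it.
\<close>

definition symmetric_coherent_algebra :: "(complex^'n^'n) set \<Rightarrow> bool" where
  "symmetric_coherent_algebra W \<longleftrightarrow>
     coherent_algebra W \<and>
     (\<exists>\<B>. coherent_configuration W \<B> \<and> (\<forall>M\<in>\<B>. transpose M = M))"

end

theory Submission
  imports Defs
begin

text \<open>
  Let \<open>W\<close> be the coherent closure, \<open>J\<close> the all-ones matrix and \<open>x\<close> the characteristic vector of the
  regular clique \<open>C\<close>; then \<open>A x = \<theta> x + e 1\<close> with \<open>\<theta> = |C| - 1 - e\<close>. If \<open>A\<^sup>2\<close> lies in
  the span of \<open>I, A, J\<close>, this span is coherent, hence equal to \<open>W\<close>, and it is symmetric. So assume it
  does not. Let \<open>P\<close> and \<open>Q\<close> be the orthogonal projections onto \<open>W\<close> of \<open>x x\<^sup>T\<close> and \<open>x 1\<^sup>T\<close>. As the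
  degree is a simple eigenvalue, \<open>Q = u 1\<^sup>T\<close> for some vector \<open>u\<close>, and \<open>P A = \<theta> P + e Q\<close>.

  If \<open>u\<close> is not constant, the six symmetric matrices \<open>I, A, J, A\<^sup>2\<close>, \<open>Q + Q\<^sup>T\<close>, \<open>diag u\<close> are
  linearly independent. If \<open>u\<close> is constant, \<open>P\<close> commutes with \<open>A\<close> and \<open>J\<close>, and it is not in the span of
  \<open>I, A, J, A\<^sup>2\<close>: since \<open>P\<close> vanishes on nonadjacent pairs, on which \<open>A\<^sup>2\<close> is not constant, it would
  be in the span of \<open>I, A\<close>, and the equation for \<open>P A\<close> would put \<open>A\<^sup>2\<close> in the span of \<open>I, A, J\<close>.

  If \<open>W\<close> is not symmetric and has dimension at most \<open>6\<close>, its symmetric part has dimension at most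
  \<open>5\<close>. This excludes the first case; in the second case the symmetric part is spanned by the commuting
  matrices \<open>I, A, J, A\<^sup>2, P\<close>, so it is closed under products, hence a coherent algebra containing \<open>A\<close>,
  which contradicts the minimality of \<open>W\<close>.
\<close>

section \<open>Cells of a coherent algebra\<close>

lemma cmat_scale_nth [simp]: "cmat_scale c A $ i $ j = c * A $ i $ j"
  by (simp add: cmat_scale_def)

lemma matrix_mult_nth: "(A ** B) $ i $ j = (\<Sum>m\<in>UNIV. A $ i $ m * B $ m $ j)"
  by (simp add: matrix_matrix_mult_def)

lemma mat_1_nth: "(mat 1 :: 'a::zero_neq_one^'n^'n) $ i $ j = of_bool (i = j)"
  by (simp add: mat_def)

lemma transpose_nth [simp]: "transpose A $ i $ j = A $ j $ i"
  by (simp add: transpose_def)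

lemma transpose_cmat_scale: "transpose (cmat_scale c A) = cmat_scale c (transpose A)"
  by (simp add: vec_eq_iff)

lemma transpose_add: "transpose (A + B) = transpose A + transpose B"
  by (simp add: vec_eq_iff)

lemma transpose_hadamard: "transpose (A * B) = transpose A * transpose B"
  by (simp add: vec_eq_iff)

lemma transpose_ones: "transpose (1 :: 'a::one^'n^'n) = 1"
  by (simp add: vec_eq_iff)

lemma transpose_diff: "transpose (A - B) = transpose A - transpose (B::'a::ab_group_add^'n^'m)"
  by (simp add: vec_eq_iff)

lemma cmat_scale_mult_left: "cmat_scale c A ** B = cmat_scale c (A ** B)"
  by (simp add: vec_eq_iff matrix_mult_nth sum_distrib_left mult.assoc)

lemma cmat_scale_mult_right: "A ** cmat_scale c B = cmat_scale c (A ** B)"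
  by (simp add: vec_eq_iff matrix_mult_nth sum_distrib_left algebra_simps)

lemma cmat_add_mult: "(A + B) ** (M :: complex^'n^'m) = A ** M + B ** M"
  by (simp add: vec_eq_iff matrix_mult_nth sum.distrib algebra_simps)

lemmas cmat_mult_simps =
  cmat_scale_mult_left cmat_scale_mult_right matrix_add_ldistrib cmat_add_mult

lemma coherent_algebraD:
  assumes "coherent_algebra W"
  shows "cmat.subspace W" "mat 1 \<in> W" "1 \<in> W"
    "A \<in> W \<Longrightarrow> transpose A \<in> W"
    "A \<in> W \<Longrightarrow> B \<in> W \<Longrightarrow> A ** B \<in> W"
    "A \<in> W \<Longrightarrow> B \<in> W \<Longrightarrow> A * B \<in> W"
    "A \<in> W \<Longrightarrow> B \<in> W \<Longrightarrow> A + B \<in> W"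
    "A \<in> W \<Longrightarrow> B \<in> W \<Longrightarrow> A - B \<in> W"
    "A \<in> W \<Longrightarrow> cmat_scale c A \<in> W"
  using assms cmat.subspace_add cmat.subspace_diff cmat.subspace_scale
  unfolding coherent_algebra_def by blast+

text \<open>For a coherent algebra \<open>W\<close> these are the relations of its coherent
  configuration, described as common level sets so that no basis has to be chosen first.\<close>

definition cell :: "(complex^'n^'n) set \<Rightarrow> 'n \<times> 'n \<Rightarrow> ('n \<times> 'n) set" where
  "cell W p = {q. \<forall>M\<in>W. M $ fst q $ snd q = M $ fst p $ snd p}"

definition cell_mat :: "(complex^'n^'n) set \<Rightarrow> 'n \<times> 'n \<Rightarrow> complex^'n^'n" where
  "cell_mat W p = (\<chi> i j. of_bool ((i, j) \<in> cell W p))"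

lemma cell_refl: "p \<in> cell W p"
  by (simp add: cell_def)

lemma cell_sym: "q \<in> cell W p \<longleftrightarrow> p \<in> cell W q"
  by (auto simp: cell_def)

lemma cell_eq: "q \<in> cell W p \<Longrightarrow> cell W q = cell W p"
  by (auto simp: cell_def)

lemma cell_mat_nth: "cell_mat W p $ i $ j = of_bool ((i, j) \<in> cell W p)"
  by (simp add: cell_mat_def)

lemma card_cell_pos: "card (cell W (p :: 'n::finite \<times> 'n)) > 0"
  using cell_refl[of p W] by (simp add: card_gt_0_iff) auto

lemma cell_mat_eq_iff: "cell_mat W p = cell_mat W q \<longleftrightarrow> p \<in> cell W q"
proof
  assume "cell_mat W p = cell_mat W q"
  then have "cell_mat W p $ fst p $ snd p = cell_mat W q $ fst p $ snd p" by simp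
  then show "p \<in> cell W q" by (simp add: cell_mat_nth cell_refl split: if_splits)
next
  assume "p \<in> cell W q"
  then show "cell_mat W p = cell_mat W q" by (simp add: cell_mat_def cell_eq)
qed

text \<open>Entrywise Lagrange interpolation: each \<open>q\<close> outside the cell is separated
  from \<open>p\<close> by some \<open>M\<close> in \<open>W\<close>, whose affine normalisation
  \<open>H\<close> is 1 at \<open>p\<close> and 0 at \<open>q\<close>. Products of such factors stay
  in \<open>W\<close>.\<close>

lemma separating_matrix:
  assumes W: "coherent_algebra W" and "finite R" "R \<inter> cell W p = {}"
  shows "\<exists>G\<in>W. G $ fst p $ snd p = 1 \<and> (\<forall>q\<in>R. G $ fst q $ snd q = 0)"
  using assms(2,3)
proof (induction R rule: finite_induct)
  case empty
  then show ?case using coherent_algebraD(3)[OF W] by (intro bexI[of _ 1]) auto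
next
  case (insert q R)
  then obtain G where G: "G \<in> W" "G $ fst p $ snd p = 1" "\<forall>q\<in>R. G $ fst q $ snd q = 0"
    by auto
  from insert obtain M where M: "M \<in> W" "M $ fst q $ snd q \<noteq> M $ fst p $ snd p"
    by (auto simp: cell_def)
  define H where "H = cmat_scale (1 / (M $ fst p $ snd p - M $ fst q $ snd q))
    (M - cmat_scale (M $ fst q $ snd q) 1)"
  have "H \<in> W" unfolding H_def by (intro coherent_algebraD[OF W] M)
  then have "G * H \<in> W" by (intro coherent_algebraD[OF W] G)
  moreover have "(G * H) $ fst p $ snd p = 1" "\<forall>q\<in>insert q R. (G * H) $ fst q $ snd q = 0"
    using G M by (auto simp: H_def)
  ultimately show ?case by blast
qed

lemma cell_mat_in:
  fixes W :: "(complex^'n^'n) set"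
  assumes W: "coherent_algebra W"
  shows "cell_mat W p \<in> W"
proof -
  obtain G where G: "G \<in> W" "G $ fst p $ snd p = 1" "\<forall>q\<in>- cell W p. G $ fst q $ snd q = 0"
    using separating_matrix[OF W, of "- cell W p" p] by auto
  have "G $ i $ j = of_bool ((i, j) \<in> cell W p)" for i j
  proof (cases "(i, j) \<in> cell W p")
    case True
    then have "G $ i $ j = G $ fst p $ snd p" using G(1) by (auto simp: cell_def)
    then show ?thesis using G True by simp
  next
    case False
    then show ?thesis using bspec[OF G(3), of "(i, j)"] by simp
  qed
  then have "G = cell_mat W p" by (simp add: vec_eq_iff cell_mat_nth)
  then show ?thesis using G by simp
qed

text \<open>The sum runs over positions instead of cells, so each cell matrix occurs once per
  element of its cell; dividing by the cardinality compensates for this.\<close>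

lemma cell_expansion:
  assumes "\<And>p q. q \<in> cell W p \<Longrightarrow> M $ fst q $ snd q = M $ fst p $ snd p"
  shows "M = (\<Sum>p\<in>UNIV. cmat_scale (M $ fst p $ snd p / of_nat (card (cell W p))) (cell_mat W p))"
proof -
  have "(\<Sum>p\<in>UNIV. M $ fst p $ snd p / of_nat (card (cell W p)) * of_bool ((i, j) \<in> cell W p))
    = M $ i $ j" for i j
  proof -
    have "(\<Sum>p\<in>UNIV. M $ fst p $ snd p / of_nat (card (cell W p)) * of_bool ((i, j) \<in> cell W p))
      = (\<Sum>p\<in>cell W (i, j). M $ fst p $ snd p / of_nat (card (cell W p)))"
      by (rule sum.mono_neutral_cong_right) (auto simp: cell_sym)
    also have "\<dots> = (\<Sum>p\<in>cell W (i, j). M $ i $ j / of_nat (card (cell W (i, j))))"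
      by (rule sum.cong) (auto simp: cell_eq assms[of _ "(i, j)"])
    also have "\<dots> = M $ i $ j" using card_cell_pos[of W "(i, j)"] by (simp add: card_gt_0_iff)
    finally show ?thesis .
  qed
  then show ?thesis by (simp add: vec_eq_iff cell_mat_nth)
qed

lemma cell_constant_in:
  assumes W: "coherent_algebra W"
    and "\<And>p q. q \<in> cell W p \<Longrightarrow> M $ fst q $ snd q = M $ fst p $ snd p"
  shows "M \<in> W"
  by (subst cell_expansion[OF assms(2)])
    (auto intro!: cmat.subspace_sum coherent_algebraD(9) coherent_algebraD(1) cell_mat_in W)

lemma sum_cell_mats:
  "(\<Sum>B\<in>range (cell_mat W). f B * B $ i $ j) = (f (cell_mat W (i, j)) :: complex)"
proof -
  have "(\<Sum>B\<in>range (cell_mat W). f B * B $ i $ j) = (\<Sum>B\<in>{cell_mat W (i, j)}. f B * B $ i $ j)"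
    by (rule sum.mono_neutral_right) (auto simp: cell_mat_nth cell_mat_eq_iff cell_sym)
  then show ?thesis by (simp add: cell_mat_nth cell_refl)
qed

lemma coherent_configuration_cells:
  assumes W: "coherent_algebra W"
  shows "coherent_configuration W (range (cell_mat W))"
  unfolding coherent_configuration_def
proof (intro conjI)
  show "cmat.independent (range (cell_mat W))"
  proof
    assume "cmat.dependent (range (cell_mat W))"
    then obtain f p where p: "f (cell_mat W p) \<noteq> 0"
      and f: "(\<Sum>B\<in>range (cell_mat W). cmat_scale (f B) B) = 0"
      by (auto simp: cmat.dependent_finite)
    from f have "(\<Sum>B\<in>range (cell_mat W). cmat_scale (f B) B) $ fst p $ snd p = 0" by simp
    then show False using p by (simp add: sum_cell_mats)
  qed
  show "cmat.span (range (cell_mat W)) = W"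
  proof (intro equalityI subsetI)
    fix M assume "M \<in> cmat.span (range (cell_mat W))"
    moreover have "cmat.span (range (cell_mat W)) \<subseteq> W"
      using cell_mat_in[OF W] coherent_algebraD[OF W] by (intro cmat.span_minimal) auto
    ultimately show "M \<in> W" by blast
  next
    fix M assume "M \<in> W"
    then have "\<And>p q. q \<in> cell W p \<Longrightarrow> M $ fst q $ snd q = M $ fst p $ snd p"
      by (auto simp: cell_def)
    from cell_expansion[where W = W and M = M, OF this]
    show "M \<in> cmat.span (range (cell_mat W))"
      by (metis (no_types, lifting) cmat.span_base cmat.span_scale cmat.span_sum rangeI)
  qed
  show "\<forall>M\<in>range (cell_mat W). \<forall>i j. M $ i $ j \<in> {0, 1}"
    by (auto simp: cell_mat_nth)
  show "\<Sum> (range (cell_mat W)) = 1"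
    using sum_cell_mats[where f = "\<lambda>_. 1" and W = W] by (simp add: vec_eq_iff)
qed

lemma symmetric_coherent_algebraI:
  assumes W: "coherent_algebra W" and "\<And>M. M \<in> W \<Longrightarrow> transpose M = M"
  shows "symmetric_coherent_algebra W"
  using assms coherent_configuration_cells[OF W] cell_mat_in[OF W]
  unfolding symmetric_coherent_algebra_def by blast

text \<open>The cell matrices form a finite basis of \<open>W\<close>. This is how the bound on the
  rank limits independent families.\<close>

lemma independent_card_le_dim:
  assumes W: "coherent_algebra W" and "cmat.independent B" "B \<subseteq> W"
  shows "card B \<le> cmat.dim W"
proof -
  have c: "cmat.independent (range (cell_mat W))" "cmat.span (range (cell_mat W)) = W"
    using coherent_configuration_cells[OF W] by (auto simp: coherent_configuration_def)
  then have "cmat.dim W = card (range (cell_mat W))"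
    by (metis cmat.dim_span cmat.dim_eq_card_independent)
  then show ?thesis
    using cmat.independent_span_bound[of "range (cell_mat W)" B] assms c by auto
qed

lemma coherent_algebra_hull: "coherent_algebra (coherent_algebra hull S)"
proof -
  have "coherent_algebra (\<Inter> F)" if "\<And>W. W \<in> F \<Longrightarrow> coherent_algebra W" for F
    using that by (auto simp: coherent_algebra_def intro!: cmat.subspace_Inter)
  then show ?thesis by (rule hull_in) auto
qed

section \<open>Orthogonal projection onto a coherent algebra\<close>

text \<open>The form \<open>tr (A\<^sup>T B)\<close>, bilinear rather than Hermitian. It is still
  nondegenerate on a coherent algebra, because distinct cell matrices are orthogonal and each pairs
  with itself to the size of its cell.\<close>

definition trace_form :: "complex^'n^'n \<Rightarrow> complex^'n^'n \<Rightarrow> complex" where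
  "trace_form A B = (\<Sum>i\<in>UNIV. \<Sum>j\<in>UNIV. A $ i $ j * B $ i $ j)"

lemma trace_form_pairs: "trace_form A B = (\<Sum>p\<in>UNIV. A $ fst p $ snd p * B $ fst p $ snd p)"
  by (simp add: trace_form_def sum.cartesian_product case_prod_beta flip: UNIV_Times_UNIV)

lemma trace_form_add: "trace_form (A + B) M = trace_form A M + trace_form B M"
  by (simp add: trace_form_def algebra_simps sum.distrib)

lemma trace_form_scale: "trace_form (cmat_scale c A) M = c * trace_form A M"
  by (simp add: trace_form_def algebra_simps sum_distrib_left)

lemma trace_form_transpose: "trace_form (transpose A) M = trace_form A (transpose M)"
  unfolding trace_form_def transpose_nth by (rule sum.swap)

lemma trace_form_hadamard: "trace_form (A * B) M = trace_form A (B * M)"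
  by (simp add: trace_form_def mult.assoc)

lemma trace_form_mult_left: "trace_form (A ** B) M = trace_form B (transpose A ** M)"
proof -
  have "trace_form (A ** B) M = (\<Sum>i\<in>UNIV. \<Sum>j\<in>UNIV. \<Sum>m\<in>UNIV. A $ i $ m * B $ m $ j * M $ i $ j)"
    by (simp add: trace_form_def matrix_mult_nth sum_distrib_right)
  also have "\<dots> = (\<Sum>i\<in>UNIV. \<Sum>m\<in>UNIV. \<Sum>j\<in>UNIV. A $ i $ m * B $ m $ j * M $ i $ j)"
    by (intro sum.cong refl sum.swap)
  also have "\<dots> = (\<Sum>m\<in>UNIV. \<Sum>i\<in>UNIV. \<Sum>j\<in>UNIV. A $ i $ m * B $ m $ j * M $ i $ j)"
    by (rule sum.swap)
  also have "\<dots> = (\<Sum>m\<in>UNIV. \<Sum>j\<in>UNIV. \<Sum>i\<in>UNIV. A $ i $ m * B $ m $ j * M $ i $ j)"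
    by (intro sum.cong refl sum.swap)
  also have "\<dots> = trace_form B (transpose A ** M)"
    by (simp add: trace_form_def matrix_mult_nth sum_distrib_left algebra_simps)
  finally show ?thesis .
qed

lemma trace_form_mult_right: "trace_form (A ** B) M = trace_form A (M ** transpose B)"
proof -
  have "trace_form (A ** B) M = trace_form (transpose B ** transpose A) (transpose M)"
    by (metis matrix_transpose_mul trace_form_transpose transpose_transpose)
  also have "\<dots> = trace_form (transpose A) (B ** transpose M)"
    by (simp add: trace_form_mult_left)
  also have "\<dots> = trace_form A (M ** transpose B)"
    by (simp add: trace_form_transpose matrix_transpose_mul)
  finally show ?thesis .
qed

text \<open>Averaging over cells is the orthogonal projection onto \<open>W\<close> with respect to
  \<open>trace_form\<close>.\<close>

definition cell_avg :: "(complex^'n^'n) set \<Rightarrow> complex^'n^'n \<Rightarrow> complex^'n^'n" where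
  "cell_avg W X = (\<chi> i j. (\<Sum>q\<in>cell W (i, j). X $ fst q $ snd q) / of_nat (card (cell W (i, j))))"

lemma cell_avg_in:
  assumes "coherent_algebra W"
  shows "cell_avg W X \<in> W"
  by (rule cell_constant_in[OF assms]) (simp add: cell_avg_def cell_eq)

lemma trace_form_cell_mat:
  "trace_form X (cell_mat W p) = (\<Sum>q\<in>cell W p. X $ fst q $ snd q)"
  unfolding trace_form_pairs
  by (rule sum.mono_neutral_cong_right) (auto simp: cell_mat_nth)

lemma trace_form_eq_cell_mats:
  assumes "M \<in> W" "\<And>p. trace_form X (cell_mat W p) = trace_form Y (cell_mat W p)"
  shows "trace_form X M = trace_form Y M"
proof -
  define f where "f p = M $ fst p $ snd p / of_nat (card (cell W p))" for p
  have M: "M = (\<Sum>p\<in>UNIV. cmat_scale (f p) (cell_mat W p))"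
    unfolding f_def by (rule cell_expansion) (use assms in \<open>auto simp: cell_def\<close>)
  have "trace_form Z M = (\<Sum>p\<in>UNIV. f p * trace_form Z (cell_mat W p))" for Z
  proof -
    have "trace_form Z M = (\<Sum>q\<in>UNIV. \<Sum>p\<in>UNIV. f p * (Z $ fst q $ snd q * cell_mat W p $ fst q $ snd q))"
      by (subst M) (simp add: trace_form_pairs sum_distrib_left algebra_simps)
    also have "\<dots> = (\<Sum>p\<in>UNIV. f p * trace_form Z (cell_mat W p))"
      by (subst sum.swap) (simp add: trace_form_pairs sum_distrib_left)
    finally show ?thesis .
  qed
  then show ?thesis using assms by simp
qed

lemma trace_form_cell_avg:
  assumes "M \<in> W"
  shows "trace_form (cell_avg W X) M = trace_form X M"
proof (rule trace_form_eq_cell_mats[OF assms])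
  fix p
  have "trace_form (cell_avg W X) (cell_mat W p) =
    (\<Sum>q\<in>cell W p. (\<Sum>q\<in>cell W p. X $ fst q $ snd q) / of_nat (card (cell W p)))"
    unfolding trace_form_cell_mat by (rule sum.cong) (auto simp: cell_avg_def cell_eq)
  then show "trace_form (cell_avg W X) (cell_mat W p) = trace_form X (cell_mat W p)"
    using card_cell_pos[of W p] by (simp add: trace_form_cell_mat)
qed

text \<open>Pairing with a cell matrix sums over that cell, so pairings with \<open>W\<close>
  determine the average. In the rules below, the proposed value lies in \<open>W\<close> and has the
  right pairings.\<close>

lemma cell_avg_unique:
  assumes W: "coherent_algebra W" and "Z \<in> W" "\<And>M. M \<in> W \<Longrightarrow> trace_form Z M = trace_form X M"
  shows "cell_avg W X = Z"
proof -
  have "cell_avg W X $ i $ j = Z $ i $ j" for i j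
  proof -
    have "(\<Sum>q\<in>cell W (i, j). X $ fst q $ snd q) = (\<Sum>q\<in>cell W (i, j). Z $ fst q $ snd q)"
      using assms(3)[OF cell_mat_in[OF W]] by (simp add: trace_form_cell_mat)
    also have "\<dots> = (\<Sum>q\<in>cell W (i, j). Z $ i $ j)"
      using assms(2) by (intro sum.cong) (auto simp: cell_def)
    finally show ?thesis using card_cell_pos[of W "(i, j)"]
      by (simp add: cell_avg_def card_gt_0_iff)
  qed
  then show ?thesis by (simp add: vec_eq_iff)
qed

lemma cell_avg_self:
  assumes "coherent_algebra W" "M \<in> W"
  shows "cell_avg W M = M"
  by (rule cell_avg_unique) (use assms in auto)

lemma cell_avg_add:
  assumes "coherent_algebra W"
  shows "cell_avg W (X + Y) = cell_avg W X + cell_avg W Y"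
  by (rule cell_avg_unique)
    (use assms in \<open>auto simp: trace_form_add trace_form_cell_avg intro!: cell_avg_in coherent_algebraD\<close>)

lemma cell_avg_scale:
  assumes "coherent_algebra W"
  shows "cell_avg W (cmat_scale c X) = cmat_scale c (cell_avg W X)"
  by (rule cell_avg_unique)
    (use assms in \<open>auto simp: trace_form_scale trace_form_cell_avg intro!: cell_avg_in coherent_algebraD\<close>)

lemma cell_avg_transpose:
  assumes "coherent_algebra W"
  shows "cell_avg W (transpose X) = transpose (cell_avg W X)"
  by (rule cell_avg_unique)
    (use assms in \<open>auto simp: trace_form_transpose trace_form_cell_avg coherent_algebraD cell_avg_in\<close>)

lemma cell_avg_hadamard:
  assumes "coherent_algebra W" "M \<in> W"
  shows "cell_avg W (X * M) = cell_avg W X * M"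
  by (rule cell_avg_unique)
    (use assms in \<open>auto simp: trace_form_hadamard trace_form_cell_avg coherent_algebraD cell_avg_in\<close>)

text \<open>Moving \<open>M\<close> across the form multiplies the test matrix by
  \<open>transpose M\<close>, which keeps it in \<open>W\<close>. This is what carries the clique
  equations over to the projections.\<close>

lemma cell_avg_mult_left:
  assumes "coherent_algebra W" "M \<in> W"
  shows "cell_avg W (M ** X) = M ** cell_avg W X"
  by (rule cell_avg_unique)
    (use assms in \<open>auto simp: trace_form_mult_left trace_form_cell_avg coherent_algebraD cell_avg_in\<close>)

lemma cell_avg_mult_right:
  assumes "coherent_algebra W" "M \<in> W"
  shows "cell_avg W (X ** M) = cell_avg W X ** M"
  by (rule cell_avg_unique)
    (use assms in \<open>auto simp: trace_form_mult_right trace_form_cell_avg coherent_algebraD cell_avg_in\<close>)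


section \<open>Spans of matrices\<close>

text \<open>Span induction in one argument, then in the other. The general \<open>f\<close> covers
  the matrix product, the entrywise product and the commutator.\<close>

lemma span_bilinear:
  assumes add: "\<And>x y z. f (x + y) z = f x z + f y z" "\<And>x y z. f z (x + y) = f z x + f z y"
    and scale: "\<And>c x z. f (cmat_scale c x) z = cmat_scale c (f x z)"
      "\<And>c x z. f z (cmat_scale c x) = cmat_scale c (f z x)"
    and V: "cmat.subspace V" and B: "\<And>x y. x \<in> B \<Longrightarrow> y \<in> B \<Longrightarrow> f x y \<in> V"
    and "M \<in> cmat.span B" "N \<in> cmat.span B"
  shows "f M N \<in> V"
proof -
  have sub: "cmat.subspace {x. g x \<in> V}"
    if "\<And>x y. g (x + y) = g x + g y" "\<And>c x. g (cmat_scale c x) = cmat_scale c (g x)" for g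
  proof -
    have "g 0 = 0" using that(2)[of 0 0] by simp
    then show ?thesis using V that unfolding cmat.subspace_def by auto
  qed
  have "cmat.span B \<subseteq> {x. f x y \<in> V}" if "y \<in> B" for y
    using sub[of "\<lambda>x. f x y"] add scale B that by (intro cmat.span_minimal) auto
  then have "cmat.span B \<subseteq> {y. f M y \<in> V}"
    using sub[of "f M"] add scale assms(7) by (intro cmat.span_minimal) auto
  then show ?thesis using assms by blast
qed

lemma span_commute:
  assumes "\<And>x y. x \<in> B \<Longrightarrow> y \<in> B \<Longrightarrow> x ** y = y ** x" "M \<in> cmat.span B" "N \<in> cmat.span B"
  shows "M ** N = N ** M"
proof -
  have "M ** N - N ** M \<in> {0}"
    by (rule span_bilinear[where f = "\<lambda>x y. x ** y - y ** x" and B = B])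
      (use assms in \<open>auto simp: cmat_mult_simps cmat.scale_right_diff_distrib\<close>)
  then show ?thesis by simp
qed

lemma span_transpose:
  assumes "\<And>x. x \<in> B \<Longrightarrow> transpose x = x" "M \<in> cmat.span B"
  shows "transpose M = M"
proof -
  have "cmat.span B \<subseteq> {x. transpose x = x}"
    using assms(1)
    by (intro cmat.span_minimal) (auto simp: cmat.subspace_def transpose_add transpose_cmat_scale vec_eq_iff)
  then show ?thesis using assms by blast
qed

lemma coherent_algebra_span:
  assumes "mat 1 \<in> B" "1 \<in> B" "\<And>x. x \<in> B \<Longrightarrow> transpose x = x"
    and "\<And>x y. x \<in> B \<Longrightarrow> y \<in> B \<Longrightarrow> x ** y \<in> cmat.span B"
    and "\<And>x y. x \<in> B \<Longrightarrow> y \<in> B \<Longrightarrow> x * y \<in> cmat.span B"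
  shows "coherent_algebra (cmat.span B)"
proof -
  have "M ** N \<in> cmat.span B" if "M \<in> cmat.span B" "N \<in> cmat.span B" for M N
    by (rule span_bilinear[where B = B]) (use assms that in \<open>auto simp: cmat_mult_simps\<close>)
  moreover have "M * N \<in> cmat.span B" if "M \<in> cmat.span B" "N \<in> cmat.span B" for M N
    by (rule span_bilinear[where B = B])
      (use assms that in \<open>auto simp: vec_eq_iff algebra_simps\<close>)
  ultimately show ?thesis
    using assms span_transpose[of B] unfolding coherent_algebra_def
    by (auto simp: cmat.span_base)
qed

text \<open>For symmetric factors \<open>transpose (M ** N)\<close> is \<open>N ** M\<close>, so
  commuting is exactly what keeps products symmetric.\<close>

lemma coherent_algebra_symmetric_part:
  assumes W: "coherent_algebra W"
    and "\<And>M N. M \<in> W \<Longrightarrow> N \<in> W \<Longrightarrow> transpose M = M \<Longrightarrow> transpose N = N \<Longrightarrow> M ** N = N ** M"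
  shows "coherent_algebra {M \<in> W. transpose M = M}"
proof -
  have "cmat.subspace {M \<in> W. transpose M = M}"
    using coherent_algebraD(1)[OF W] unfolding cmat.subspace_def
    by (auto simp: transpose_add transpose_cmat_scale vec_eq_iff)
  then show ?thesis
    using coherent_algebraD[OF W] assms(2) unfolding coherent_algebra_def
    by (simp add: matrix_transpose_mul transpose_ones transpose_hadamard)
qed

text \<open>The three facts are bundled so that extensions by one matrix can be chained.\<close>

lemma independent_insert_card:
  assumes "cmat.independent B \<and> finite B \<and> card B = n" "x \<notin> cmat.span B"
  shows "cmat.independent (insert x B) \<and> finite (insert x B) \<and> card (insert x B) = Suc n"
  using assms cmat.span_base[of x B] by (auto simp: cmat.independent_insert card_insert_if)

section \<open>Regular cliques in edge-regular graphs\<close>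

lemma sum_of_bool_card: "(\<Sum>x\<in>(UNIV :: 'a::finite set). of_bool (R x)) = (of_nat (card {x. R x}) :: 'b::semiring_1)"
  by (simp add: sum.If_cases of_bool_def)

locale regular_clique_graph =
  fixes adj :: "'v::finite \<Rightarrow> 'v \<Rightarrow> bool" and C :: "'v set" and k l e :: nat
  assumes adj_sym: "adj u v \<Longrightarrow> adj v u"
    and adj_irrefl: "\<not> adj v v"
    and not_complete: "\<not> complete_graph adj"
    and degree: "card {u. adj v u} = k"
    and common: "adj u v \<Longrightarrow> card {w. adj u w \<and> adj v w} = l"
    and clique: "clique adj C"
    and e_pos: "e > 0"
    and outside: "v \<notin> C \<Longrightarrow> card {u \<in> C. adj v u} = e"
begin

definition A :: "complex^'v^'v" where "A = adjacency_matrix adj"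

definition th :: complex where "th = of_nat (card C) - 1 - of_nat e"

text \<open>With \<open>x\<close> the characteristic vector of \<open>C\<close>, this is
  \<open>x x\<^sup>T\<close>, and \<open>K\<close> is \<open>x 1\<^sup>T\<close>.\<close>

definition X :: "complex^'v^'v" where "X = (\<chi> i j. of_bool (i \<in> C \<and> j \<in> C))"

definition K :: "complex^'v^'v" where "K = (\<chi> i j. of_bool (i \<in> C))"

lemma A_nth: "A $ i $ j = of_bool (adj i j)"
  by (simp add: A_def adjacency_matrix_def)

lemma adj_iff: "adj i j \<longleftrightarrow> adj j i"
  using adj_sym by blast

lemma transpose_A: "transpose A = A"
  using adj_iff by (simp add: vec_eq_iff A_nth)

lemma exists_nonadjacent: obtains a b where "a \<noteq> b" "\<not> adj a b"
  using not_complete by (auto simp: complete_graph_def)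

lemma exists_outside: obtains v where "v \<notin> C"
  using not_complete clique by (auto simp: complete_graph_def clique_def)

lemma exists_neighbour_in_clique:
  assumes "v \<notin> C"
  obtains u where "u \<in> C" "adj v u"
proof -
  have "{u \<in> C. adj v u} \<noteq> {}" using outside[OF assms] e_pos by (metis card.empty less_irrefl)
  then show ?thesis using that by blast
qed

text \<open>By regularity, one vertex adjacent to all others would give every vertex full degree,
  making the graph complete.\<close>

lemma not_dominating: "\<exists>w. w \<noteq> v \<and> \<not> adj v w"
proof (rule ccontr)
  assume "\<not> ?thesis"
  then have "{u. adj v u} = UNIV - {v}" using adj_irrefl by auto
  then have k: "k = CARD('v) - 1" using degree[of v] by (simp add: card_Diff_singleton)
  obtain a b where ab: "a \<noteq> b" "\<not> adj a b" by (rule exists_nonadjacent)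
  have "{u. adj a u} \<subseteq> UNIV - {a}" using adj_irrefl by auto
  moreover have "card (UNIV - {a}) = card {u. adj a u}"
    using degree[of a] k by (simp add: card_Diff_singleton)
  ultimately have "{u. adj a u} = UNIV - {a}" by (intro card_seteq) auto
  then show False using ab by auto
qed

text \<open>A vertex outside \<open>C\<close> has a neighbour in \<open>C\<close>, so
  \<open>C\<close> is nonempty. If \<open>C\<close> were a single vertex, every other vertex would
  be adjacent to it, against \<open>not_dominating\<close>.\<close>

lemma card_C: "card C \<ge> 2"
proof -
  obtain v where "v \<notin> C" by (rule exists_outside)
  then obtain u where u: "u \<in> C" by (rule exists_neighbour_in_clique)
  obtain w where w: "w \<noteq> u" "\<not> adj u w" using not_dominating by blast
  have "C \<noteq> {u}"
  proof
    assume "C = {u}"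
    moreover from this w have "w \<notin> C" by simp
    ultimately show False using exists_neighbour_in_clique[of w] w adj_sym by blast
  qed
  then obtain u' where "u' \<in> C" "u' \<noteq> u" using u by blast
  then have "card {u, u'} \<le> card C" using u by (intro card_mono) auto
  then show ?thesis using \<open>u' \<noteq> u\<close> by simp
qed

lemma exists_adjacent: obtains a b where "adj a b"
proof -
  obtain v where "v \<notin> C" by (rule exists_outside)
  then show ?thesis using exists_neighbour_in_clique that by blast
qed

text \<open>A vertex outside \<open>C\<close> has \<open>e\<close> of its \<open>k\<close>
  neighbours in \<open>C\<close>, so \<open>e \<le> k\<close>, and \<open>card C \<ge> 2\<close>
  makes the sum positive. This factor is cancelled in \<open>Q_relation_trivial\<close>.\<close>

lemma k_plus_th: "of_nat k + th \<noteq> 0"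
proof
  assume "of_nat k + th = 0"
  then have "(of_nat (k + card C) :: complex) = of_nat (1 + e)"
    by (simp add: th_def algebra_simps)
  then have "k + card C = 1 + e" by (simp only: of_nat_eq_iff)
  moreover obtain v where v: "v \<notin> C" by (rule exists_outside)
  have "e \<le> k"
    unfolding outside[OF v, symmetric] degree[of v, symmetric] by (intro card_mono) auto
  ultimately show False using card_C by simp
qed

lemma sum_A: "(\<Sum>m\<in>UNIV. A $ i $ m) = of_nat k"
  by (simp only: A_nth sum_of_bool_card degree)

lemma A_one: "A ** 1 = cmat_scale (of_nat k) 1"
  by (simp add: vec_eq_iff matrix_mult_nth sum_A)

lemma one_A: "1 ** A = cmat_scale (of_nat k) 1"
proof -
  have "transpose (A ** 1) = transpose (cmat_scale (of_nat k) 1)" by (simp add: A_one)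
  then show ?thesis
    by (simp add: matrix_transpose_mul transpose_A transpose_cmat_scale transpose_ones)
qed

lemma A_A_nth: "(A ** A) $ i $ j = of_nat (card {w. adj i w \<and> adj j w})"
proof -
  have "(A ** A) $ i $ j = (\<Sum>m\<in>UNIV. of_bool (adj i m \<and> adj j m))"
    unfolding matrix_mult_nth A_nth using adj_iff by (intro sum.cong) auto
  then show ?thesis by (simp only: sum_of_bool_card)
qed

text \<open>A vertex of \<open>C\<close> has \<open>card C - 1\<close>, that is
  \<open>th + e\<close>, neighbours in \<open>C\<close>, and any other vertex has
  \<open>e\<close>.\<close>

lemma sum_A_clique: "(\<Sum>m\<in>UNIV. A $ i $ m * of_bool (m \<in> C)) = th * of_bool (i \<in> C) + of_nat e"
proof -
  have "(\<Sum>m\<in>UNIV. A $ i $ m * of_bool (m \<in> C)) = (\<Sum>m\<in>UNIV. of_bool (m \<in> C \<and> adj i m))"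
    unfolding A_nth by (intro sum.cong) auto
  also have "\<dots> = of_nat (card {m \<in> C. adj i m})" by (simp only: sum_of_bool_card)
  also have "\<dots> = th * of_bool (i \<in> C) + of_nat e"
  proof (cases "i \<in> C")
    case True
    then have "{m \<in> C. adj i m} = C - {i}" using clique adj_irrefl by (auto simp: clique_def)
    then show ?thesis using True card_C by (simp add: th_def card_Diff_singleton)
  qed (simp add: outside)
  finally show ?thesis .
qed

lemma A_K: "A ** K = cmat_scale th K + cmat_scale (of_nat e) 1"
  by (simp add: vec_eq_iff matrix_mult_nth K_def sum_A_clique)

lemma K_A: "K ** A = cmat_scale (of_nat k) K"
proof -
  have "(\<Sum>m\<in>UNIV. A $ m $ j) = of_nat k" for j
    using sum_A[of j] by (simp add: A_nth adj_iff[of _ j])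
  then show ?thesis
    by (simp add: vec_eq_iff matrix_mult_nth K_def flip: sum_distrib_left)
qed

lemma transpose_X: "transpose X = X"
  by (auto simp: vec_eq_iff X_def)

lemma X_A: "X ** A = cmat_scale th X + cmat_scale (of_nat e) K"
proof -
  have "(\<Sum>m\<in>UNIV. of_bool (i \<in> C \<and> m \<in> C) * A $ m $ j)
    = th * of_bool (i \<in> C \<and> j \<in> C) + of_nat e * of_bool (i \<in> C)" for i j
  proof -
    have "(\<Sum>m\<in>UNIV. of_bool (i \<in> C \<and> m \<in> C) * A $ m $ j)
      = (\<Sum>m\<in>UNIV. of_bool (i \<in> C) * (A $ j $ m * of_bool (m \<in> C)))"
      by (intro sum.cong) (auto simp: A_nth adj_iff)
    also have "\<dots> = of_bool (i \<in> C) * (th * of_bool (j \<in> C) + of_nat e)"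
      by (simp only: sum_A_clique flip: sum_distrib_left)
    finally show ?thesis by (simp add: of_bool_conj algebra_simps)
  qed
  then show ?thesis by (simp add: vec_eq_iff matrix_mult_nth X_def K_def)
qed

text \<open>The pairing counts the ordered pairs of distinct vertices of \<open>C\<close>.\<close>

lemma trace_form_X_A: "trace_form X A \<noteq> 0"
proof -
  have "trace_form X A = (\<Sum>i\<in>UNIV. of_bool (i \<in> C) * (\<Sum>j\<in>UNIV. A $ i $ j * of_bool (j \<in> C)))"
    unfolding trace_form_def X_def sum_distrib_left
    by (intro sum.cong) auto
  also have "\<dots> = (\<Sum>i\<in>UNIV. (th + of_nat e) * of_bool (i \<in> C))"
    by (intro sum.cong) (auto simp: sum_A_clique)
  also have "\<dots> = (th + of_nat e) * of_nat (card C)"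
    by (simp only: sum_of_bool_card Collect_mem_eq flip: sum_distrib_left)
  also have "\<dots> = of_nat ((card C - 1) * card C)"
    using card_C by (simp add: th_def)
  also have "\<dots> \<noteq> 0" using card_C by (subst of_nat_eq_0_iff) auto
  finally show ?thesis .
qed

lemma X_nonadjacent: "X * (1 - mat 1 - A) = 0"
  using clique adj_irrefl by (auto simp: vec_eq_iff X_def A_nth mat_1_nth clique_def)

text \<open>
  The degree is a simple eigenvalue: the Laplacian quadratic form vanishes only on vectors that are
  constant along edges, and the regular clique makes the graph connected.
\<close>

lemma degree_eigenvector_real:
  fixes y :: "'v \<Rightarrow> real"
  assumes ev: "\<And>i. (\<Sum>j\<in>UNIV. of_bool (adj i j) * y j) = of_nat k * y i"
  shows "y i = y j"
proof -
  have row: "(\<Sum>j\<in>UNIV. of_bool (adj i j)) = real k" for i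
    by (simp only: sum_of_bool_card degree)
  have "(\<Sum>i\<in>UNIV. \<Sum>j\<in>UNIV. of_bool (adj i j) * (y i - y j)\<^sup>2)
    = (\<Sum>i\<in>UNIV. \<Sum>j\<in>UNIV. of_bool (adj i j) * (y i)\<^sup>2)
      - 2 * (\<Sum>i\<in>UNIV. y i * (\<Sum>j\<in>UNIV. of_bool (adj i j) * y j))
      + (\<Sum>i\<in>UNIV. \<Sum>j\<in>UNIV. of_bool (adj i j) * (y j)\<^sup>2)"
    unfolding sum_distrib_left sum_subtractf[symmetric] sum.distrib[symmetric]
    by (intro sum.cong refl) (simp add: power2_eq_square algebra_simps)
  also have "(\<Sum>i\<in>UNIV. \<Sum>j\<in>UNIV. of_bool (adj i j) * (y j)\<^sup>2)
      = (\<Sum>i\<in>UNIV. \<Sum>j\<in>UNIV. of_bool (adj i j) * (y i)\<^sup>2)"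
    by (subst sum.swap) (simp add: adj_iff)
  also have "(\<Sum>i\<in>UNIV. \<Sum>j\<in>UNIV. of_bool (adj i j) * (y i)\<^sup>2) = (\<Sum>i\<in>UNIV. real k * (y i)\<^sup>2)"
    by (simp only: row flip: sum_distrib_right)
  also have "(\<Sum>i\<in>UNIV. y i * (\<Sum>j\<in>UNIV. of_bool (adj i j) * y j)) = (\<Sum>i\<in>UNIV. real k * (y i)\<^sup>2)"
    by (simp only: ev) (simp add: power2_eq_square algebra_simps)
  finally have "(\<Sum>i\<in>UNIV. \<Sum>j\<in>UNIV. of_bool (adj i j) * (y i - y j)\<^sup>2) = 0" by simp
  then have "of_bool (adj i j) * (y i - y j)\<^sup>2 = 0" for i j
    by (simp add: sum_nonneg_eq_0_iff sum_nonneg)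
  then have edge: "y i = y j" if "adj i j" for i j
    using that by (metis of_bool_eq(2) power_eq_0_iff right_minus_eq mult_1)
  obtain v where "v \<notin> C" by (rule exists_outside)
  then obtain c where c: "c \<in> C" by (rule exists_neighbour_in_clique)
  have inside: "y i = y c" if "i \<in> C" for i
    using that c clique edge by (metis clique_def)
  have "y i = y c" for i
    by (cases "i \<in> C") (use inside edge exists_neighbour_in_clique in metis)+
  then show ?thesis by metis
qed

text \<open>As \<open>A\<close> is real, the real and imaginary parts of each column satisfy the
  eigenvector equation separately.\<close>

lemma degree_eigenmatrix:
  assumes "A ** M = cmat_scale (of_nat k) M"
  shows "M $ i $ j = M $ i' $ j"
proof -
  have ev: "(\<Sum>m\<in>UNIV. of_bool (adj i m) * M $ m $ j) = of_nat k * M $ i $ j" for i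
    using arg_cong[OF assms, of "\<lambda>N. N $ i $ j"] by (simp add: matrix_mult_nth A_nth)
  have [simp]: "Re (of_bool b * z) = of_bool b * Re z" "Im (of_bool b * z) = of_bool b * Im z" for b z
    by (cases b; simp)+
  have "(\<Sum>m\<in>UNIV. of_bool (adj i m) * Re (M $ m $ j)) = of_nat k * Re (M $ i $ j)"
    "(\<Sum>m\<in>UNIV. of_bool (adj i m) * Im (M $ m $ j)) = of_nat k * Im (M $ i $ j)" for i
    using arg_cong[OF ev, of Re i] arg_cong[OF ev, of Im i]
    by simp_all
  then show ?thesis
    using degree_eigenvector_real[of "\<lambda>m. Re (M $ m $ j)" i i']
      degree_eigenvector_real[of "\<lambda>m. Im (M $ m $ j)" i i']
    by (simp add: complex_eq_iff)
qed

section \<open>The span of I, A, J and the square of A; the strongly regular case\<close>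

lemma A_A_cases:
  "(A ** A) $ i $ j = (if i = j then of_nat k else if adj i j then of_nat l else (A ** A) $ i $ j)"
  by (simp add: A_A_nth degree common)

lemma span_I_A_J:
  "M \<in> cmat.span {1, A, mat 1} \<longleftrightarrow>
    (\<exists>a b z. M = cmat_scale z 1 + cmat_scale b A + cmat_scale a (mat 1))"
  (is "?L \<longleftrightarrow> ?R")
  by (auto simp: cmat.span_breakdown_eq algebra_simps) (metis add.commute)+

text \<open>Edge-regularity fixes the other entries of \<open>A ** A\<close>, so the graph is
  strongly regular; the coefficients of \<open>A\<close> and \<open>mat 1\<close> correct
  \<open>m\<close> to \<open>l\<close> on edges and to \<open>k\<close> on the diagonal.\<close>

lemma square_in_spanI:
  assumes "\<And>i j. i \<noteq> j \<Longrightarrow> \<not> adj i j \<Longrightarrow> (A ** A) $ i $ j = m"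
  shows "A ** A \<in> cmat.span {1, A, mat 1}"
  unfolding span_I_A_J
proof (intro exI)
  show "A ** A = cmat_scale m 1 + cmat_scale (of_nat l - m) A + cmat_scale (of_nat k - m) (mat 1)"
    unfolding vec_eq_iff
    by (subst A_A_cases) (use assms adj_irrefl in \<open>auto simp: A_nth mat_1_nth\<close>)
qed

lemma coherent_algebra_span_I_A_J:
  assumes "A ** A \<in> cmat.span {1, A, mat 1}"
  shows "coherent_algebra (cmat.span {1, A, mat 1})"
proof (rule coherent_algebra_span)
  have J: "(1 :: complex^'v^'v) ** 1 = cmat_scale (of_nat CARD('v)) (1 :: complex^'v^'v)"
    by (simp add: vec_eq_iff matrix_mult_nth)
  show "x ** y \<in> cmat.span {1, A, mat 1}" if "x \<in> {1, A, mat 1}" "y \<in> {1, A, mat 1}" for x y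
    using that assms by (auto simp: J A_one one_A cmat.span_scale cmat.span_base)
  have "A * A = A" "A * mat 1 = 0" "mat 1 * A = 0" "mat 1 * mat 1 = (mat 1 :: complex^'v^'v)"
    using adj_irrefl by (auto simp: vec_eq_iff A_nth mat_1_nth)
  then show "x * y \<in> cmat.span {1, A, mat 1}" if "x \<in> {1, A, mat 1}" "y \<in> {1, A, mat 1}" for x y
    using that by (auto intro: cmat.span_base cmat.span_zero)
qed (auto simp: transpose_A transpose_ones)

text \<open>The matrices \<open>mat 1\<close>, \<open>A\<close> and \<open>1\<close> are added in
  this order, each detected at one position: on the diagonal, on an edge, on a nonadjacent pair. The
  hypothesis takes care of \<open>A ** A\<close>.\<close>

lemma independent_powers:
  assumes "A ** A \<notin> cmat.span {1, A, mat 1}"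
  shows "cmat.independent {A ** A, 1, A, mat 1} \<and> finite {A ** A, 1, A, mat 1}
    \<and> card {A ** A, 1, A, mat 1} = 4"
proof -
  obtain a b where ab: "adj a b" by (rule exists_adjacent)
  then have "a \<noteq> b" using adj_irrefl by auto
  obtain c d where cd: "c \<noteq> d" "\<not> adj c d" by (rule exists_nonadjacent)
  have "(mat 1 :: complex^'v^'v) $ a $ a \<noteq> 0" by (simp add: mat_1_nth)
  then have 1: "mat 1 \<notin> cmat.span ({} :: (complex^'v^'v) set)" by auto
  have "A $ a $ b \<noteq> cmat_scale z (mat 1) $ a $ b" for z
    using ab \<open>a \<noteq> b\<close> by (simp add: A_nth mat_1_nth)
  then have "A \<noteq> cmat_scale z (mat 1)" for z by metis
  then have 2: "A \<notin> cmat.span {mat 1}" by (simp add: cmat.span_breakdown_eq)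
  have "(1 - cmat_scale y A) $ c $ d \<noteq> cmat_scale z (mat 1) $ c $ d" for y z
    using cd by (simp add: A_nth mat_1_nth)
  then have "1 - cmat_scale y A \<noteq> cmat_scale z (mat 1)" for y z by metis
  then have 3: "1 \<notin> cmat.span {A, mat 1}" by (simp add: cmat.span_breakdown_eq)
  have 0: "cmat.independent ({} :: (complex^'v^'v) set)
      \<and> finite ({} :: (complex^'v^'v) set) \<and> card ({} :: (complex^'v^'v) set) = 0"
    by (simp add: cmat.independent_empty)
  show ?thesis
    using independent_insert_card[OF independent_insert_card[OF independent_insert_card[OF
          independent_insert_card[OF 0 1] 2] 3] assms]
    by (simp add: eval_nat_numeral)
qed

lemma span_powersE:
  assumes "M \<in> cmat.span {A ** A, 1, A, mat 1}"
  obtains a b z w where "M = cmat_scale a (mat 1) + cmat_scale b A + cmat_scale z 1 + cmat_scale w (A ** A)"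
proof -
  obtain w where "M - cmat_scale w (A ** A) \<in> cmat.span {1, A, mat 1}"
    using assms by (subst (asm) cmat.span_breakdown_eq) auto
  then obtain a b z where "M - cmat_scale w (A ** A) = cmat_scale z 1 + cmat_scale b A + cmat_scale a (mat 1)"
    unfolding span_I_A_J by auto
  then show ?thesis by (intro that[of a b z w]) (simp add: algebra_simps)
qed

lemma transpose_A_A: "transpose (A ** A) = A ** A"
  by (simp add: matrix_transpose_mul transpose_A)

lemma powers_commute:
  assumes "x \<in> {A ** A, 1, A, mat 1}" "y \<in> {A ** A, 1, A, mat 1}"
  shows "x ** y = y ** x"
proof -
  have "1 ** (A ** A) = (A ** A) ** 1"
    by (simp add: matrix_mul_assoc one_A cmat_mult_simps)
      (simp add: A_one one_A cmat_mult_simps flip: matrix_mul_assoc)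
  then show ?thesis using assms by (auto simp: A_one one_A matrix_mul_assoc)
qed

end

section \<open>Projections of the clique matrices onto a coherent algebra containing A\<close>

locale coherent_clique_graph = regular_clique_graph adj C k l e
  for adj :: "'v::finite \<Rightarrow> 'v \<Rightarrow> bool" and C k l e +
  fixes W :: "(complex^'v^'v) set"
  assumes W: "coherent_algebra W" and A_in_W: "A \<in> W"
begin

definition P :: "complex^'v^'v" where "P = cell_avg W X"

definition Q :: "complex^'v^'v" where "Q = cell_avg W K"

lemma P_in_W: "P \<in> W" and Q_in_W: "Q \<in> W"
  by (simp_all add: P_def Q_def cell_avg_in W)

lemma transpose_P: "transpose P = P"
  by (simp add: P_def transpose_X flip: cell_avg_transpose[OF W])

lemma P_A: "P ** A = cmat_scale th P + cmat_scale (of_nat e) Q"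
  by (simp add: P_def Q_def X_A cell_avg_add[OF W] cell_avg_scale[OF W]
      flip: cell_avg_mult_right[OF W A_in_W])

lemma A_Q: "A ** Q = cmat_scale th Q + cmat_scale (of_nat e) 1"
  by (simp add: Q_def A_K cell_avg_add[OF W] cell_avg_scale[OF W] cell_avg_self[OF W]
      coherent_algebraD(3)[OF W] flip: cell_avg_mult_left[OF W A_in_W])

text \<open>Projecting \<open>K_A\<close> shows that the rows of \<open>Q\<close> satisfy the
  eigenvector equation for the degree, so they are constant and \<open>Q = u 1\<^sup>T\<close> with
  \<open>u\<close> the diagonal of \<open>Q\<close>.\<close>

lemma Q_row_constant: "Q $ i $ j = Q $ i $ i"
proof -
  have "Q ** A = cmat_scale (of_nat k) Q"
    by (simp add: Q_def K_A cell_avg_scale[OF W] flip: cell_avg_mult_right[OF W A_in_W])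
  then have "transpose (Q ** A) = transpose (cmat_scale (of_nat k) Q)" by simp
  then have "A ** transpose Q = cmat_scale (of_nat k) (transpose Q)"
    by (simp add: matrix_transpose_mul transpose_A transpose_cmat_scale)
  from degree_eigenmatrix[OF this, of j i i] show ?thesis by simp
qed

text \<open>The adjacency matrix of the complement is in \<open>W\<close>, so entrywise
  multiplication by it commutes with projecting, and it annihilates \<open>X\<close> because
  \<open>C\<close> is a clique.\<close>

lemma P_nonadjacent: "i \<noteq> j \<Longrightarrow> \<not> adj i j \<Longrightarrow> P $ i $ j = 0"
proof -
  assume ij: "i \<noteq> j" "\<not> adj i j"
  have "1 - mat 1 - A \<in> W" by (intro coherent_algebraD[OF W] A_in_W)
  from cell_avg_hadamard[OF W this, of X] have "P * (1 - mat 1 - A) = 0"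
    by (simp add: P_def X_nonadjacent cell_avg_self[OF W] cmat.subspace_0 coherent_algebraD(1)[OF W])
  then have "(P * (1 - mat 1 - A)) $ i $ j = 0" by simp
  then show ?thesis using ij by (simp add: A_nth mat_1_nth)
qed

text \<open>For constant \<open>Q\<close> the right-hand side of \<open>P_A\<close> is symmetric,
  and symmetric matrices with a symmetric product commute.\<close>

lemma P_A_commute:
  assumes "\<And>i j. Q $ i $ j = g"
  shows "P ** A = A ** P"
proof -
  have "transpose Q = Q" by (simp add: vec_eq_iff assms)
  then have "transpose (P ** A) = P ** A"
    by (simp add: P_A transpose_add transpose_cmat_scale transpose_P)
  then show ?thesis by (simp add: matrix_transpose_mul transpose_A transpose_P)
qed

text \<open>Commuting with \<open>A\<close> makes the row sums of \<open>P\<close> satisfy the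
  eigenvector equation for the degree, so they are all equal; by symmetry the column sums have the
  same value.\<close>

lemma P_one_commute:
  assumes "P ** A = A ** P"
  shows "P ** 1 = 1 ** P"
proof -
  let ?J = "1 :: complex^'v^'v"
  have "A ** (P ** ?J) = P ** (A ** ?J)" by (simp only: matrix_mul_assoc assms)
  then have "A ** (P ** ?J) = cmat_scale (of_nat k) (P ** ?J)"
    by (simp add: A_one cmat_mult_simps)
  then have "(P ** ?J) $ i $ j = (P ** ?J) $ j $ j" for i j by (rule degree_eigenmatrix)
  moreover have "(P ** ?J) $ i $ j = (?J ** P) $ j $ i" for i j
    using arg_cong[OF transpose_P, of "\<lambda>M. M $ _ $ _"]
    by (simp add: matrix_mult_nth)
  ultimately show ?thesis
    by (simp add: vec_eq_iff) (simp add: matrix_mult_nth)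
qed

lemma P_notin_span_powers:
  assumes sq: "A ** A \<notin> cmat.span {1, A, mat 1}" and Q: "\<And>i j. Q $ i $ j = g"
  shows "P \<notin> cmat.span {A ** A, 1, A, mat 1}"
proof
  assume "P \<in> cmat.span {A ** A, 1, A, mat 1}"
  then obtain a b z w where
    P: "P = cmat_scale a (mat 1) + cmat_scale b A + cmat_scale z 1 + cmat_scale w (A ** A)"
    by (rule span_powersE)
  have nonadj: "z + w * (A ** A) $ i $ j = 0" if "i \<noteq> j" "\<not> adj i j" for i j
    using P_nonadjacent[OF that] that by (simp add: P A_nth mat_1_nth)
  have "w = 0"
  proof (rule ccontr)
    assume "w \<noteq> 0"
    then have "(A ** A) $ i $ j = - z / w" if "i \<noteq> j" "\<not> adj i j" for i j
      using nonadj[OF that] by (simp add: field_simps eq_neg_iff_add_eq_0)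
    then show False using square_in_spanI sq by blast
  qed
  moreover obtain c d where "c \<noteq> d" "\<not> adj c d" by (rule exists_nonadjacent)
  ultimately have "z = 0" using nonadj[of c d] by simp
  have P: "P = cmat_scale a (mat 1) + cmat_scale b A"
    using P \<open>w = 0\<close> \<open>z = 0\<close> by (simp add: vec_eq_iff)
  \<comment> \<open>Otherwise \<open>P\<close> would be diagonal and orthogonal to \<open>A\<close>,
    but its pairing with \<open>A\<close> is the nonzero pairing of \<open>X\<close> with
    \<open>A\<close>.\<close>
  have "b \<noteq> 0"
  proof
    assume "b = 0"
    have "trace_form X A = trace_form P A"
      by (simp add: P_def trace_form_cell_avg A_in_W)
    also have "\<dots> = 0"
      using \<open>b = 0\<close> adj_irrefl
      by (auto simp: P trace_form_def mat_1_nth A_nth intro!: sum.neutral)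
    finally show False using trace_form_X_A by simp
  qed
  have "P ** A = cmat_scale a A + cmat_scale b (A ** A)"
    by (simp add: P cmat_mult_simps)
  then have *: "a * A $ i $ j + b * (A ** A) $ i $ j = th * P $ i $ j + of_nat e * g" for i j
    using P_A by (simp add: vec_eq_iff Q)
  \<comment> \<open>On nonadjacent pairs the terms with \<open>A\<close> and \<open>P\<close>
    vanish, leaving a constant.\<close>
  have "(A ** A) $ i $ j = of_nat e * g / b" if "i \<noteq> j" "\<not> adj i j" for i j
    using *[of i j] that \<open>b \<noteq> 0\<close> by (simp add: P_nonadjacent A_nth field_simps)
  then show False using square_in_spanI sq by blast
qed

text \<open>
  Writing \<open>Q = u 1\<^sup>T\<close>, a relation with \<open>b \<noteq> 0\<close> makes \<open>u\<^sub>i + u\<^sub>j\<close> constant along edges; summing over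
  the neighbours of \<open>i\<close> forces \<^term>\<open>th\<close> to be the negative of the degree.
\<close>

lemma Q_relation_trivial:
  assumes Q: "Q $ p $ p \<noteq> Q $ q $ q"
    and "cmat_scale b (Q + transpose Q) + cmat_scale d (Q * mat 1) \<in> cmat.span {A ** A, 1, A, mat 1}"
  shows "b = 0 \<and> d = 0"
proof -
  define u where "u i = Q $ i $ i" for i
  have Q_u: "Q $ i $ j = u i" for i j using Q_row_constant by (simp add: u_def)
  define L where "L = cmat_scale b (Q + transpose Q) + cmat_scale d (Q * mat 1)"
  have L_nth: "L $ i $ j = b * (u i + u j) + d * (if i = j then u i else 0)" for i j
    by (simp add: L_def Q_u mat_1_nth)
  obtain a1 a2 a3 a4 where
    L: "L = cmat_scale a1 (mat 1) + cmat_scale a2 A + cmat_scale a3 1 + cmat_scale a4 (A ** A)"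
    using assms(2) unfolding L_def[symmetric] by (rule span_powersE)
  \<comment> \<open>The common row sum of the right-hand side. The row sums of \<open>L\<close> are
    affine in \<open>u i\<close> with slope \<open>b * of_nat CARD('v) + d\<close>, which must
    vanish as \<open>u\<close> is not constant.\<close>
  define s where "s = a1 + a2 * of_nat k + a3 * of_nat CARD('v) + a4 * of_nat (k * k)"
  have "(A ** A) ** 1 = cmat_scale (of_nat (k * k)) 1"
    by (simp add: A_one cmat_mult_simps flip: matrix_mul_assoc)
  moreover have "(1 :: complex^'v^'v) ** 1 = cmat_scale (of_nat CARD('v)) (1 :: complex^'v^'v)"
    by (simp add: vec_eq_iff matrix_mult_nth)
  ultimately have "L ** 1 = cmat_scale s 1"
    by (simp add: L cmat_mult_simps A_one s_def vec_eq_iff)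
  then have "(\<Sum>j\<in>UNIV. L $ i $ j) = s" for i
    by (simp add: vec_eq_iff matrix_mult_nth)
  moreover have "(\<Sum>j\<in>UNIV. L $ i $ j) = (b * of_nat CARD('v) + d) * u i + b * (\<Sum>j\<in>UNIV. u j)" for i
    unfolding L_nth by (simp add: sum.distrib algebra_simps flip: sum_distrib_left)
  ultimately have "(b * of_nat CARD('v) + d) * u p = (b * of_nat CARD('v) + d) * u q"
    by (metis add_right_cancel)
  then have bd: "b * of_nat CARD('v) + d = 0" using Q by (simp add: u_def)
  have "b = 0"
  proof (rule ccontr)
    assume "b \<noteq> 0"
    define t where "t = (a2 + a3 + a4 * of_nat l) / b"
    have edge: "u i + u j = t" if "adj i j" for i j
    proof -
      have "i \<noteq> j" using that adj_irrefl by auto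
      then have "b * (u i + u j) = a2 + a3 + a4 * of_nat l"
        using arg_cong[OF L, of "\<lambda>M. M $ i $ j"] L_nth[of i j] that
        by (simp add: A_nth mat_1_nth A_A_nth common)
      then show ?thesis using \<open>b \<noteq> 0\<close> by (simp add: t_def field_simps)
    qed
    have "(of_nat k + th) * u i = of_nat k * t - of_nat e" for i
    proof -
      have "(\<Sum>j\<in>UNIV. A $ i $ j * (u i + u j)) = (\<Sum>j\<in>UNIV. A $ i $ j * t)"
        by (intro sum.cong) (auto simp: A_nth edge)
      also have "\<dots> = of_nat k * t" by (simp only: sum_A flip: sum_distrib_right)
      finally have "of_nat k * u i + (\<Sum>j\<in>UNIV. A $ i $ j * u j) = of_nat k * t"
        by (simp add: algebra_simps sum.distrib sum_A flip: sum_distrib_left)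
      \<comment> \<open>The equation \<open>A_Q\<close> gives the sum of \<open>u\<close> over the
        neighbours of \<open>i\<close>.\<close>
      moreover have "(\<Sum>j\<in>UNIV. A $ i $ j * u j) = th * u i + of_nat e"
        using arg_cong[OF A_Q, of "\<lambda>M. M $ i $ i"] by (simp add: matrix_mult_nth Q_u)
      ultimately show ?thesis by (simp add: algebra_simps)
    qed
    then have "(of_nat k + th) * u p = (of_nat k + th) * u q" by simp
    then show False using k_plus_th Q by (simp add: u_def)
  qed
  then show ?thesis using bd by simp
qed

section \<open>Dimension count for the symmetric part\<close>

lemma powers_subset_W: "{A ** A, 1, A, mat 1} \<subseteq> W"
  using coherent_algebraD[OF W] A_in_W by auto

lemma powers_symmetric: "x \<in> {A ** A, 1, A, mat 1} \<Longrightarrow> transpose x = x"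
  by (auto simp: transpose_A transpose_A_A transpose_ones)

lemma commuting_symmetric_part:
  assumes dim: "cmat.dim W \<le> 6" and sq: "A ** A \<notin> cmat.span {1, A, mat 1}"
    and Y: "Y \<in> W" "transpose Y \<noteq> Y"
    and MN: "M \<in> W" "N \<in> W" "transpose M = M" "transpose N = N"
  shows "M ** N = N ** M"
proof -
  let ?B = "{A ** A, 1, A, mat 1}"
  \<comment> \<open>A nonzero antisymmetric matrix lies outside the span of every symmetric family,
    so adjoining it leaves room for only five independent symmetric matrices.\<close>
  define Z where "Z = Y - transpose Y"
  have Z_in: "Z \<in> W" unfolding Z_def by (intro coherent_algebraD[OF W] Y)
  have Z_anti: "transpose Z = - Z" by (simp add: Z_def transpose_diff)
  have Z_notin: "Z \<notin> cmat.span B" if "\<And>x. x \<in> B \<Longrightarrow> transpose x = x" for B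
  proof
    assume "Z \<in> cmat.span B"
    then have "transpose Z = Z" by (rule span_transpose[rotated]) (rule that)
    then have "Y $ j $ i - Y $ i $ j = - (Y $ j $ i - Y $ i $ j)" for i j
      by (simp add: Z_def vec_eq_iff)
    then have "Y $ j $ i = Y $ i $ j" for i j
      by (metis eq_iff_diff_eq_0 eq_neg_iff_add_eq_0 mult_2 mult_eq_0_iff zero_neq_numeral)
    then show False using Y(2) by (simp add: vec_eq_iff)
  qed
  have card_le: "card B \<le> 6" if "cmat.independent B" "B \<subseteq> W" for B
    using independent_card_le_dim[OF W that] dim by simp
  note B4 = independent_powers[OF sq]
  have "\<exists>g. \<forall>i j. Q $ i $ j = g"
  proof (rule ccontr)
    assume "\<not> ?thesis"
    then obtain p q where pq: "Q $ p $ p \<noteq> Q $ q $ q" using Q_row_constant by metis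
    define T where "T = Q + transpose Q"
    define D where "D = Q * mat 1"
    have rel: "b = 0 \<and> d = 0" if "cmat_scale b T + cmat_scale d D \<in> cmat.span ?B" for b d
      using Q_relation_trivial[OF pq] that by (simp add: T_def D_def)
    have T: "T \<notin> cmat.span ?B" using rel[of 1 0] by auto
    \<comment> \<open>Membership of \<open>D\<close> in the larger span would be a relation with
      coefficients \<open>- b\<close> and 1.\<close>
    have "D - cmat_scale b T \<notin> cmat.span ?B" for b using rel[of "- b" 1] by auto
    then have D: "D \<notin> cmat.span (insert T ?B)" by (subst cmat.span_breakdown_eq) auto
    have "transpose T = T" "transpose D = D"
      by (auto simp: T_def D_def transpose_add vec_eq_iff mat_1_nth)
    then have "Z \<notin> cmat.span (insert D (insert T ?B))"
      by (intro Z_notin) (use powers_symmetric in blast)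
    from independent_insert_card[OF independent_insert_card[OF independent_insert_card[OF B4 T] D] this]
    have "cmat.independent (insert Z (insert D (insert T ?B)))"
      "card (insert Z (insert D (insert T ?B))) = 7"
      by simp_all
    moreover have "insert Z (insert D (insert T ?B)) \<subseteq> W"
      using powers_subset_W Z_in Q_in_W coherent_algebraD[OF W] by (auto simp: T_def D_def)
    ultimately show False using card_le by fastforce
  qed
  then obtain g where g: "\<And>i j. Q $ i $ j = g" by auto
  let ?S = "insert P ?B"
  have sym: "x \<in> ?S \<Longrightarrow> transpose x = x" for x
    using powers_symmetric transpose_P by auto
  note B6 = independent_insert_card[OF
      independent_insert_card[OF B4 P_notin_span_powers[OF sq g]] Z_notin[OF sym]]
  have in_span: "M \<in> cmat.span ?S" if M: "M \<in> W" "transpose M = M" for M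
  proof -
    \<comment> \<open>The set \<open>insert Z ?S\<close> already has six independent elements, so a
      seventh would exceed the bound.\<close>
    have "M \<in> cmat.span (insert Z ?S)"
    proof (rule ccontr)
      assume "M \<notin> cmat.span (insert Z ?S)"
      from independent_insert_card[OF B6 this]
      have "cmat.independent (insert M (insert Z ?S))" "card (insert M (insert Z ?S)) = 7"
        by simp_all
      moreover have "insert M (insert Z ?S) \<subseteq> W" using powers_subset_W Z_in P_in_W M by auto
      ultimately show False using card_le by fastforce
    qed
    then obtain c where c: "M - cmat_scale c Z \<in> cmat.span ?S"
      unfolding cmat.span_breakdown_eq[of M Z] by blast
    \<comment> \<open>Transposing fixes \<open>M\<close> and negates \<open>Z\<close>, so the
      contribution of \<open>Z\<close> vanishes.\<close>
    from span_transpose[OF sym this] have "cmat_scale c Z = cmat_scale c (- Z)"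
      by (simp add: transpose_diff transpose_cmat_scale M Z_anti)
    then have "cmat_scale c Z = 0" by (simp add: vec_eq_iff)
    then show ?thesis using c by (simp only: diff_zero)
  qed
  have PA: "P ** A = A ** P" by (rule P_A_commute[OF g])
  have "P ** (A ** A) = (A ** A) ** P" by (metis PA matrix_mul_assoc)
  then have "x ** y = y ** x" if "x \<in> ?S" "y \<in> ?S" for x y
    using that powers_commute[of x y] PA P_one_commute[OF PA] by auto
  then show ?thesis by (rule span_commute[OF _ in_span[OF MN(1,3)] in_span[OF MN(2,4)]])
qed

end

theorem theorem2p7:
  fixes adj :: "'v::finite \<Rightarrow> 'v \<Rightarrow> bool"
  assumes "neumaier_graph adj"
    and "coherent_rank adj \<le> 6"
  shows "symmetric_coherent_algebra (coherent_closure adj)"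
proof -
  from assms(1) obtain C k l e where "regular_clique_graph adj C k l e"
    by (auto simp: neumaier_graph_def regular_clique_graph_def simple_graph_def edge_regular_def
        symp_def irreflp_def)
  then interpret regular_clique_graph adj C k l e .
  let ?W = "coherent_closure adj"
  have W: "coherent_algebra ?W" and "A \<in> ?W"
    using hull_inc[of A "{A}" coherent_algebra]
    by (auto simp: coherent_closure_def coherent_algebra_hull A_def)
  then interpret coherent_clique_graph adj C k l e ?W
    by unfold_locales
  have minimal: "?W \<subseteq> V" if "coherent_algebra V" "A \<in> V" for V
    using hull_minimal[of "{A}" V coherent_algebra] that by (simp add: coherent_closure_def A_def)
  have "transpose Y = Y" if Y: "Y \<in> ?W" for Y
  proof (rule ccontr)
    assume "transpose Y \<noteq> Y"
    show False
    proof (cases "A ** A \<in> cmat.span {1, A, mat 1}")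
      case True
      have "A \<in> cmat.span {1, A, mat 1}" by (simp add: cmat.span_base)
      \<comment> \<open>In the strongly regular case the closure lies in a span of symmetric
        matrices.\<close>
      from minimal[OF coherent_algebra_span_I_A_J[OF True] this]
      have "Y \<in> cmat.span {1, A, mat 1}" using Y by (rule subsetD)
      then have "transpose Y = Y"
        by (rule span_transpose[rotated]) (auto simp: transpose_A transpose_ones)
      then show False using \<open>transpose Y \<noteq> Y\<close> by simp
    next
      case False
      have "cmat.dim ?W \<le> 6" using assms(2) by (simp add: coherent_rank_def)
      from commuting_symmetric_part[OF this False Y \<open>transpose Y \<noteq> Y\<close>]
      have "coherent_algebra {M \<in> ?W. transpose M = M}"
        by (intro coherent_algebra_symmetric_part W)
      moreover have "A \<in> {M \<in> ?W. transpose M = M}" by (simp add: A_in_W transpose_A)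
      ultimately have "Y \<in> {M \<in> ?W. transpose M = M}" by (rule subsetD[OF minimal Y])
      then show False using \<open>transpose Y \<noteq> Y\<close> by simp
    qed
  qed
  then show ?thesis by (intro symmetric_coherent_algebraI W)
qed

end
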